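(* Let $N=\{1,\ldots,n\}$ and let $C \subset \mathbb{Z}^n$ be a bounded integral hole-free set. The following statements are equivalent: (1) $C$ has a least weakly $(1,b)$-submajorized element for each $b \in \mathbb{Z}^n$; (2) for each $b \in \mathbb{Z}^n$, there exists $x^* \in C$ that is an optimal solution to $\min_{x \in C} \Phi(x+b)$ for any choice of non-decreasing continuous Schur-convex function $\Phi:\mathbb{R}^n\to\mathbb{R}$; (3) for each permutation $\pi$ of $N$, there exists $x^* \in C$ such that for all $x \in C$ we have $\sum_{i=1}^k x^*_{\pi(i)} \leq \sum_{i=1}^k x_{\pi(i)}$ for all $k \in N$; (4) the function $g(A) := \min_{x \in C} x(A)$, $A\subseteq N$, is integral and supermodular and $B_{\text{sup}}^{\mathbb{Z}}(g) \subseteq C \subseteq P_{\text{sup}}^{\mathbb{Z}}(g)$.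
   Context: Notation: $x(A) := \sum_{i\in A} x_i$ for $x\in\mathbb{R}^n$, $A\subseteq N$; in "$(1,b)$", $1$ is the all-ones vector. "Integral" means integer-valued. A set $C\subseteq\mathbb{Z}^n$ is hole-free if $C=\mathrm{co}(C)\cap\mathbb{Z}^n$, where $\mathrm{co}$ denotes convex hull. Weak $(1,b)$-submajorization: $x$ is weakly $(1,b)$-submajorized by $y$ if $\sum_{i\in N}\phi(x_i+b_i)\le \sum_{i\in N}\phi(y_i+b_i)$ for all non-decreasing continuous convex functions $\phi:\mathbb{R}\to\mathbb{R}$. A vector $x\in C$ is a least weakly $(1,b)$-submajorized element of $C$ if $x$ is weakly $(1,b)$-submajorized by every $y\in C$. Schur-convexity: let $x^{\downarrow}$ denote the rearrangement of $x$ in non-increasing order; $x\prec y$ if $\sum_{i=1}^k x^{\downarrow}_i\le\sum_{i=1}^k y^{\downarrow}_i$ for all $k\in N$ and $x(N)=y(N)$. $\Phi:\mathbb{R}^n\to\mathbb{R}$ is Schur-convex if $x\prec y$ implies $\Phi(x)\le\Phi(y)$. $\Phi$ is non-decreasing if it is non-decreasing with respect to the componentwise order. Supermodularity: $g:2^N\to\mathbb{R}$ with $g(\emptyset)=0$ is supermodular if $g(A)+g(B)\le g(A\cup B)+g(A\cap B)$ for all $A,B\subseteq N$. $P^{\mathbb{Z}}_{\text{sup}}(g):=\{x\in\mathbb{Z}^n : x(A)\ge g(A)\ \forall A\subseteq N\}$ and $B^{\mathbb{Z}}_{\text{sup}}(g):=\{x\in P^{\mathbb{Z}}_{\text{sup}}(g):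 x(N)=g(N)\}$. *)

theory Defs
  imports "HOL-Analysis.Analysis"
begin

text \<open>
  The ground set \<open>N = {1,...,n}\<close> is a finite linearly ordered index type \<open>'n\<close>, so that
  \<open>{..k}\<close> for \<open>k :: 'n\<close> plays the role of \<open>{1,...,k}\<close>. Integral vectors are
  regarded as elements of \<open>real ^ 'n\<close>, since they are used in convex hulls and as arguments of
  real functions. The order on \<open>real ^ 'n\<close> is the componentwise one.
\<close>

definition integer_vectors :: "(real ^ 'n) set" where
  "integer_vectors = {x. \<forall>i. x $ i \<in> \<int>}"

definition vsum :: "real ^ 'n \<Rightarrow> 'n set \<Rightarrow> real" where
  "vsum x A = (\<Sum>i\<in>A. x $ i)"

definition hole_free :: "(real ^ 'n) set \<Rightarrow> bool" where
  "hole_free C \<longleftrightarrow> C = convex hull C \<inter> integer_vectors"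

definition weakly_submajorized :: "real ^ 'n \<Rightarrow> real ^ 'n \<Rightarrow> real ^ 'n \<Rightarrow> bool" where
  "weakly_submajorized b x y \<longleftrightarrow>
    (\<forall>\<phi> :: real \<Rightarrow> real. mono \<phi> \<longrightarrow> continuous_on UNIV \<phi> \<longrightarrow> convex_on UNIV \<phi> \<longrightarrow>
      (\<Sum>i\<in>UNIV. \<phi> (x $ i + b $ i)) \<le> (\<Sum>i\<in>UNIV. \<phi> (y $ i + b $ i)))"

definition least_weakly_submajorized ::
    "real ^ 'n \<Rightarrow> (real ^ 'n) set \<Rightarrow> real ^ 'n \<Rightarrow> bool" where
  "least_weakly_submajorized b C x \<longleftrightarrow> x \<in> C \<and> (\<forall>y\<in>C. weakly_submajorized b x y)"

text \<open>The non-increasing rearrangement, as a list; its entries are indexed from 0.\<close>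

definition decreasing_rearrangement :: "real ^ 'n::{finite,linorder} \<Rightarrow> real list" where
  "decreasing_rearrangement x = rev (sort (map (\<lambda>i. x $ i) (sorted_list_of_set UNIV)))"

definition majorized :: "real ^ 'n::{finite,linorder} \<Rightarrow> real ^ 'n::{finite,linorder} \<Rightarrow> bool" where
  "majorized x y \<longleftrightarrow>
    (\<forall>k\<in>{1..CARD('n)}. (\<Sum>i<k. decreasing_rearrangement x ! i)
                         \<le> (\<Sum>i<k. decreasing_rearrangement y ! i)) \<and>
    vsum x UNIV = vsum y UNIV"

definition schur_convex :: "(real ^ 'n::{finite,linorder} \<Rightarrow> real) \<Rightarrow> bool" where
  "schur_convex \<Phi> \<longleftrightarrow> (\<forall>x y. majorized x y \<longrightarrow> \<Phi> x \<le> \<Phi> y)"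

definition supermodular :: "('n set \<Rightarrow> real) \<Rightarrow> bool" where
  "supermodular g \<longleftrightarrow> g {} = 0 \<and> (\<forall>A B. g A + g B \<le> g (A \<union> B) + g (A \<inter> B))"

definition P_sup :: "('n set \<Rightarrow> real) \<Rightarrow> (real ^ 'n) set" where
  "P_sup g = {x \<in> integer_vectors. \<forall>A. vsum x A \<ge> g A}"

definition B_sup :: "('n set \<Rightarrow> real) \<Rightarrow> (real ^ 'n) set" where
  "B_sup g = {x \<in> P_sup g. vsum x UNIV = g UNIV}"

text \<open>
  For a bounded \<open>C \<subseteq> integer_vectors\<close> the set under \<open>Min\<close> is finite. For empty \<open>C\<close> the value is
  an unspecified constant \<open>c\<close>; then \<open>supermodular\<close> forces \<open>c = 0\<close>, and \<open>B_sup\<close> of the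
  zero function is \<open>{0}\<close>, which is not contained in \<open>C\<close>.
\<close>

definition min_fun :: "(real ^ 'n) set \<Rightarrow> 'n set \<Rightarrow> real" where
  "min_fun C A = Min ((\<lambda>x. vsum x A) ` C)"

end

theory Submission
  imports Defs
begin

text \<open>
  The implications are proved in the cycle (1), (3), (4), (2), (1). A hinge function \<open>max 0 (u - t)\<close>
  and a shift \<open>b\<close> that separates the components turn (1) into (3). From (3), one \<open>xs\<close> attains
  \<open>g (A \<inter> B)\<close> and \<open>g (A \<union> B)\<close> simultaneously, so \<open>g\<close> is supermodular; a point of \<open>B_sup g\<close>
  outside the convex hull of \<open>C\<close> would be separated by a weight \<open>w\<close>, but the \<open>xs\<close> for the
  ordering of \<open>w\<close> has the smaller weight. For (4) implies (2), \<open>b\<close> is absorbed into \<open>g\<close>. For a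
  minimiser of a strictly convex separable function, the components above an integer \<open>t\<close> lie in a
  tight set all of whose components are at least \<open>t\<close>; hence the minimiser has least
  \<open>\<Sum> max 0 (x_i - t)\<close> for every integer \<open>t\<close>, which is weak majorization for integral vectors.
  Finally (2) implies (1) by Karamata's inequality.
\<close>

section \<open>Sums of largest components\<close>

definition top_sum :: "real ^ 'n::{finite,linorder} \<Rightarrow> nat \<Rightarrow> real" where
  "top_sum x k = (\<Sum>i<k. decreasing_rearrangement x ! i)"

text \<open>For k between 1 and n, \<open>top_sum x k\<close> is the minimum over \<open>t\<close>
  of \<open>k * t + hinge_sum x t\<close>. This dual form replaces comparisons of sorted partial
  sums by comparisons that need no sorting.\<close>

definition hinge_sum :: "real ^ 'n \<Rightarrow> real \<Rightarrow> real" where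
  "hinge_sum x t = (\<Sum>i\<in>UNIV. max 0 (x $ i - t))"

lemma length_decreasing_rearrangement [simp]:
  "length (decreasing_rearrangement (x :: real ^ 'n::{finite,linorder})) = CARD('n)"
  by (simp add: decreasing_rearrangement_def)

lemma set_decreasing_rearrangement: "set (decreasing_rearrangement x) = range (($) x)"
  by (simp add: decreasing_rearrangement_def)

lemma decreasing_rearrangement_antimono:
  fixes x :: "real ^ 'n::{finite,linorder}"
  assumes "i \<le> j" "j < CARD('n)"
  shows "decreasing_rearrangement x ! j \<le> decreasing_rearrangement x ! i"
  using assms by (auto simp: decreasing_rearrangement_def rev_nth intro!: sorted_nth_mono)

lemma sum_decreasing_rearrangement:
  fixes x :: "real ^ 'n::{finite,linorder}" and f :: "real \<Rightarrow> real"
  shows "(\<Sum>i\<in>UNIV. f (x $ i)) = (\<Sum>i<CARD('n). f (decreasing_rearrangement x ! i))"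
proof -
  let ?l = "map (\<lambda>i. x $ i) (sorted_list_of_set UNIV)"
  have "(\<Sum>i\<in>UNIV. f (x $ i)) = sum_list (map f ?l)"
    using sum.distinct_set_conv_list[of "sorted_list_of_set (UNIV :: 'n set)" "\<lambda>i. f (x $ i)"]
    by (simp add: comp_def)
  also have "\<dots> = sum_mset (image_mset f (mset ?l))"
    by (metis mset_map sum_mset_sum_list)
  also have "mset ?l = mset (decreasing_rearrangement x)"
    by (simp add: decreasing_rearrangement_def)
  also have "sum_mset (image_mset f \<dots>) = sum_list (map f (decreasing_rearrangement x))"
    by (metis mset_map sum_mset_sum_list)
  also have "\<dots> = (\<Sum>i<CARD('n). f (decreasing_rearrangement x ! i))"
    by (simp add: sum_list_sum_nth atLeast0LessThan)
  finally show ?thesis .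
qed

lemma top_sum_card: "top_sum (x :: real ^ 'n::{finite,linorder}) CARD('n) = vsum x UNIV"
  using sum_decreasing_rearrangement[of "\<lambda>u. u" x] by (simp add: top_sum_def vsum_def)

text \<open>Termwise, \<open>u\<close> is at most \<open>t + max 0 (u - t)\<close>. The bound keeps
  only the first \<open>k\<close> hinge terms because one application has to leave out the smallest
  entry.\<close>

lemma top_sum_le_hinge_part:
  "top_sum x k \<le> real k * t + (\<Sum>i<k. max 0 (decreasing_rearrangement x ! i - t))"
proof -
  have "top_sum x k \<le> (\<Sum>i<k. t + max 0 (decreasing_rearrangement x ! i - t))"
    unfolding top_sum_def by (rule sum_mono) auto
  then show ?thesis by (simp add: sum.distrib)
qed

lemma top_sum_le_hinge_sum:
  fixes x :: "real ^ 'n::{finite,linorder}"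
  assumes "k \<le> CARD('n)"
  shows "top_sum x k \<le> real k * t + hinge_sum x t"
proof -
  have "(\<Sum>i<k. max 0 (decreasing_rearrangement x ! i - t)) \<le> hinge_sum x t"
    unfolding hinge_sum_def sum_decreasing_rearrangement[of "\<lambda>u. max 0 (u - t)"]
    using assms by (intro sum_mono2) auto
  with top_sum_le_hinge_part[of x k t] show ?thesis by linarith
qed

text \<open>With the \<open>k\<close>-th largest entry as threshold (index \<open>k - 1\<close>
  counting from 0), the first \<open>k\<close> entries are not truncated and all later ones
  contribute zero.\<close>

lemma top_sum_eq_hinge_sum:
  fixes x :: "real ^ 'n::{finite,linorder}"
  assumes "1 \<le> k" "k \<le> CARD('n)"
  defines "t \<equiv> decreasing_rearrangement x ! (k - 1)"
  shows "top_sum x k = real k * t + hinge_sum x t"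
proof -
  let ?d = "\<lambda>i. decreasing_rearrangement x ! i"
  have "hinge_sum x t = (\<Sum>i<CARD('n). max 0 (?d i - t))"
    unfolding hinge_sum_def by (rule sum_decreasing_rearrangement)
  also have "\<dots> = (\<Sum>i<k. max 0 (?d i - t))"
  proof (rule sum.mono_neutral_right)
    show "\<forall>i\<in>{..<CARD('n)} - {..<k}. max 0 (?d i - t) = 0"
      using assms(1) decreasing_rearrangement_antimono[of "k - 1" _ x] by (auto simp: t_def)
  qed (use assms in auto)
  also have "\<dots> = (\<Sum>i<k. ?d i - t)"
  proof (rule sum.cong[OF refl])
    fix i assume "i \<in> {..<k}"
    then have "?d (k - 1) \<le> ?d i"
      using assms by (intro decreasing_rearrangement_antimono) auto
    then show "max 0 (?d i - t) = ?d i - t" by (simp add: t_def)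
  qed
  finally show ?thesis by (simp add: top_sum_def sum_subtractf)
qed

text \<open>Take the threshold at which the hinge bound is an equality for \<open>y\<close>; for
  \<open>x\<close> it is still an upper bound. Only entries of \<open>y\<close> occur as thresholds,
  so integer thresholds suffice for integral \<open>y\<close>.\<close>

lemma top_sum_mono_if_hinge_sum_mono:
  fixes x y :: "real ^ 'n::{finite,linorder}"
  assumes "1 \<le> k" "k \<le> CARD('n)"
    and "\<And>t. t \<in> range (($) y) \<Longrightarrow> hinge_sum x t \<le> hinge_sum y t"
  shows "top_sum x k \<le> top_sum y k"
proof -
  let ?t = "decreasing_rearrangement y ! (k - 1)"
  have "?t \<in> set (decreasing_rearrangement y)"
    using assms by (intro nth_mem) auto
  then have "hinge_sum x ?t \<le> hinge_sum y ?t"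
    by (simp add: set_decreasing_rearrangement assms(3))
  with top_sum_le_hinge_sum[of k x ?t] top_sum_eq_hinge_sum[of k y] assms show ?thesis
    by linarith
qed

lemma majorized_iff_top_sum:
  fixes x y :: "real ^ 'n::{finite,linorder}"
  shows "majorized x y \<longleftrightarrow>
    (\<forall>k\<in>{1..CARD('n)}. top_sum x k \<le> top_sum y k) \<and> vsum x UNIV = vsum y UNIV"
  by (simp add: majorized_def top_sum_def)

text \<open>Lowering a smallest component of \<open>y\<close> only affects the sum of all components.\<close>

lemma majorized_below_if_top_sum_le:
  fixes x y :: "real ^ 'n::{finite,linorder}"
  assumes top: "\<And>k. k \<in> {1..CARD('n)} \<Longrightarrow> top_sum x k \<le> top_sum y k"
  obtains v where "v \<le> y" "majorized x v"
proof -
  obtain j where j: "\<And>i. y $ j \<le> y $ i"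
  proof -
    have "Min (range (($) y)) \<in> range (($) y)" by (rule Min_in) auto
    then obtain j where "Min (range (($) y)) = y $ j" by (rule rangeE)
    moreover have "Min (range (($) y)) \<le> y $ i" for i by (rule Min_le) auto
    ultimately show ?thesis using that[of j] by simp
  qed
  define \<delta> where "\<delta> = vsum y UNIV - vsum x UNIV"
  define v where "v = y - axis j \<delta>"
  have "\<delta> \<ge> 0"
    using top[of "CARD('n)"] by (simp add: \<delta>_def top_sum_card Suc_leI)
  have vi: "v $ i = (if i = j then y $ i - \<delta> else y $ i)" for i
    by (simp add: v_def axis_def)
  have "v \<le> y" using \<open>\<delta> \<ge> 0\<close> by (simp add: less_eq_vec_def vi)
  have vs: "vsum v UNIV = vsum x UNIV"
    by (simp add: v_def vsum_def sum_subtractf axis_def \<delta>_def)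
  have "top_sum x k \<le> top_sum v k" if k: "k \<in> {1..CARD('n)}" for k
  proof (cases "k = CARD('n)")
    case True
    then show ?thesis by (simp add: top_sum_card vs)
  next
    case False
    with k have kn: "1 \<le> k" "k \<le> CARD('n) - 1" by auto
    \<comment> \<open>At this threshold the hinge bound is exact for \<open>v\<close>. As
      \<open>k\<close> is below the dimension, the bound for \<open>y\<close> may drop the last
      sorted entry, which is at least \<open>y $ j\<close>; what is left is at most the hinge sum
      over the components other than \<open>j\<close>, where \<open>y\<close> and \<open>v\<close>
      agree.\<close>
    let ?t = "decreasing_rearrangement v ! (k - 1)"
    let ?d = "\<lambda>i. decreasing_rearrangement y ! i"
    have last: "{..<CARD('n)} = insert (CARD('n) - 1) {..<CARD('n) - 1}" using kn by auto
    have "?d (CARD('n) - 1) \<in> set (decreasing_rearrangement y)"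
      using kn by (intro nth_mem) auto
    then have "y $ j \<le> ?d (CARD('n) - 1)"
      using j by (auto simp: set_decreasing_rearrangement)
    moreover have "hinge_sum y ?t = (\<Sum>i<CARD('n) - 1. max 0 (?d i - ?t))
        + max 0 (?d (CARD('n) - 1) - ?t)"
      unfolding hinge_sum_def sum_decreasing_rearrangement[of "\<lambda>u. max 0 (u - ?t)"]
      by (subst last) (simp add: add.commute)
    moreover have "(\<Sum>i<k. max 0 (?d i - ?t)) \<le> (\<Sum>i<CARD('n) - 1. max 0 (?d i - ?t))"
      using kn by (intro sum_mono2) auto
    moreover have "hinge_sum y ?t - max 0 (y $ j - ?t) \<le> hinge_sum v ?t"
    proof -
      have "hinge_sum y ?t - max 0 (y $ j - ?t) = (\<Sum>i\<in>UNIV - {j}. max 0 (y $ i - ?t))"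
        unfolding hinge_sum_def by (subst sum.remove[of UNIV j]) auto
      also have "\<dots> = (\<Sum>i\<in>UNIV - {j}. max 0 (v $ i - ?t))"
        by (intro sum.cong) (auto simp: vi)
      also have "\<dots> \<le> hinge_sum v ?t"
        unfolding hinge_sum_def by (intro sum_mono2) auto
      finally show ?thesis .
    qed
    moreover have "top_sum v k = real k * ?t + hinge_sum v ?t"
      using k by (intro top_sum_eq_hinge_sum) auto
    ultimately have "top_sum y k \<le> top_sum v k"
      using top_sum_le_hinge_part[of y k ?t] by linarith
    with top[OF k] show ?thesis by linarith
  qed
  then show ?thesis using that[of v] \<open>v \<le> y\<close> vs by (simp add: majorized_iff_top_sum)
qed

section \<open>Karamata's inequality\<close>

text \<open>Abel summation, in a form that needs no enumeration of \<open>S\<close>.\<close>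

lemma sum_mult_nonneg_if_upper_sums_nonneg:
  fixes c d :: "'a \<Rightarrow> real"
  assumes "finite S" "\<And>i. i \<in> S \<Longrightarrow> 0 \<le> c i"
    and "\<And>U. U \<subseteq> S \<Longrightarrow> (\<And>i j. i \<in> U \<Longrightarrow> j \<in> S \<Longrightarrow> c i \<le> c j \<Longrightarrow> j \<in> U) \<Longrightarrow> 0 \<le> sum d U"
  shows "0 \<le> (\<Sum>i\<in>S. c i * d i)"
  using assms
proof (induction S arbitrary: c rule: finite_psubset_induct)
  case (psubset S)
  show ?case
  proof (cases "S = {}")
    case False
    \<comment> \<open>Peel off the smallest weight \<open>m\<close>, which leaves a sum over
      \<open>S'\<close> plus \<open>m * sum d S\<close>. Upper sets of \<open>S'\<close> are upper
      sets of \<open>S\<close>, and \<open>S\<close> itself is one, so both parts are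
      nonnegative.\<close>
    define m where "m = Min (c ` S)"
    have "m \<in> c ` S" using False psubset.hyps by (auto simp: m_def)
    then obtain l where l: "l \<in> S" "c l = m" by auto
    have m: "m \<le> c i" if "i \<in> S" for i using that psubset.hyps by (simp add: m_def)
    define S' where "S' = {i \<in> S. m < c i}"
    have S': "S' \<subset> S" using l by (auto simp: S'_def)
    have "0 \<le> (\<Sum>i\<in>S'. (c i - m) * d i)"
    proof (rule psubset.IH[OF S'])
      fix U assume U: "U \<subseteq> S'" "\<And>i j. i \<in> U \<Longrightarrow> j \<in> S' \<Longrightarrow> c i - m \<le> c j - m \<Longrightarrow> j \<in> U"
      show "0 \<le> sum d U"
      proof (rule psubset.prems(2))
        show "U \<subseteq> S" using U S' by auto
        fix i j assume "i \<in> U" "j \<in> S" "c i \<le> c j"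
        with U show "j \<in> U" by (fastforce simp: S'_def)
      qed
    qed (auto simp: S'_def)
    also have "(\<Sum>i\<in>S'. (c i - m) * d i) = (\<Sum>i\<in>S. (c i - m) * d i)"
      using psubset.hyps m by (intro sum.mono_neutral_left) (force simp: S'_def)+
    also have "\<dots> = (\<Sum>i\<in>S. c i * d i) - m * sum d S"
      by (simp add: left_diff_distrib sum_subtractf sum_distrib_left)
    finally have "m * sum d S \<le> (\<Sum>i\<in>S. c i * d i)" by simp
    moreover have "0 \<le> sum d S" by (rule psubset.prems(2)) auto
    moreover have "0 \<le> m" using l psubset.prems(1) by auto
    ultimately show ?thesis by (smt (verit) mult_nonneg_nonneg)
  qed auto
qed

text \<open>The right derivative, an infimum of difference quotients, serves as \<open>c\<close>.
  Adding the subgradient inequalities at \<open>u\<close> and \<open>v\<close> gives its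
  monotonicity; comparing \<open>u\<close> with \<open>u - 1\<close> gives its sign.\<close>

lemma subgradient_exists:
  fixes \<phi> :: "real \<Rightarrow> real"
  assumes "mono \<phi>" "convex_on UNIV \<phi>"
  obtains c where "mono c" "\<And>u. 0 \<le> c u" "\<And>u v. \<phi> u + c u * (v - u) \<le> \<phi> v"
proof -
  define c where "c u = Inf ((\<lambda>t. (\<phi> u - \<phi> t) / (u - t)) ` ({u<..} \<inter> UNIV))" for u
  have c: "\<phi> u + c u * (v - u) \<le> \<phi> v" for u v
    using convex_le_Inf_differential[OF assms(2), of u v] by (simp add: c_def)
  have "c u \<le> c v" if "u \<le> v" for u v
  proof (cases "u = v")
    case False
    have "c u * (v - u) \<le> c v * (v - u)" using c[of u v] c[of v u] by (simp add: algebra_simps)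
    then show ?thesis using False that by simp
  qed simp
  moreover have "0 \<le> c u" for u
    using c[of u "u - 1"] monoD[OF assms(1), of "u - 1" u] by simp
  ultimately show ?thesis using that[of c] c by (auto intro: monoI)
qed

lemma downset_nat_eq_lessThan:
  fixes U :: "nat set"
  assumes "U \<subseteq> {..<n}" "\<And>i j. i \<in> U \<Longrightarrow> j \<le> i \<Longrightarrow> j \<in> U"
  obtains k where "k \<le> n" "U = {..<k}"
proof (cases "U = {}")
  case True
  then show ?thesis using that[of 0] by simp
next
  case False
  have "finite U" using assms(1) finite_subset by blast
  have "U = {..<Suc (Max U)}"
    using assms(2)[of "Max U"] Max_in[OF \<open>finite U\<close> False] \<open>finite U\<close> by (auto simp: less_Suc_eq_le)
  moreover have "Suc (Max U) \<le> n" using False \<open>finite U\<close> assms(1) by (auto simp: Suc_le_eq)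
  ultimately show ?thesis using that by blast
qed

text \<open>Subgradients reduce the claim to a weighted sum of differences of sorted entries. The
  weights are non-increasing along the sorted order, so their upper sets are initial segments of
  indices, on which the differences add up to a difference of top sums. Abel summation
  concludes.\<close>

lemma weak_karamata:
  fixes x y :: "real ^ 'n::{finite,linorder}" and \<phi> :: "real \<Rightarrow> real"
  assumes "mono \<phi>" "convex_on UNIV \<phi>"
    and top: "\<And>k. k \<in> {1..CARD('n)} \<Longrightarrow> top_sum x k \<le> top_sum y k"
  shows "(\<Sum>i\<in>UNIV. \<phi> (x $ i)) \<le> (\<Sum>i\<in>UNIV. \<phi> (y $ i))"
proof -
  obtain c where c: "mono c" "\<And>u. 0 \<le> c u" "\<And>u v. \<phi> u + c u * (v - u) \<le> \<phi> v"
    using subgradient_exists[OF assms(1,2)] by metis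
  let ?x = "\<lambda>i. decreasing_rearrangement x ! i" and ?y = "\<lambda>i. decreasing_rearrangement y ! i"
  have "0 \<le> (\<Sum>i<CARD('n). c (?x i) * (?y i - ?x i))"
  proof (rule sum_mult_nonneg_if_upper_sums_nonneg)
    fix U assume U: "U \<subseteq> {..<CARD('n)}"
      "\<And>i j. i \<in> U \<Longrightarrow> j \<in> {..<CARD('n)} \<Longrightarrow> c (?x i) \<le> c (?x j) \<Longrightarrow> j \<in> U"
    have "j \<in> U" if "i \<in> U" "j \<le> i" for i j
      using that U(1) by (intro U(2)[OF that(1)] monoD[OF c(1)] decreasing_rearrangement_antimono) auto
    then obtain k where k: "k \<le> CARD('n)" "U = {..<k}"
      using downset_nat_eq_lessThan[OF U(1)] by metis
    then show "0 \<le> (\<Sum>i\<in>U. ?y i - ?x i)"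
      using top[of k] by (cases "k = 0") (auto simp: top_sum_def sum_subtractf)
  qed (use c in auto)
  also have "\<dots> \<le> (\<Sum>i<CARD('n). \<phi> (?y i) - \<phi> (?x i))"
    using c(3) by (intro sum_mono) (smt (verit))
  finally show ?thesis by (simp add: sum_decreasing_rearrangement sum_subtractf)
qed

lemma schur_convex_sum:
  assumes "mono \<phi>" "convex_on UNIV \<phi>"
  shows "schur_convex (\<lambda>x :: real ^ 'n::{finite,linorder}. \<Sum>i\<in>UNIV. \<phi> (x $ i))"
  unfolding schur_convex_def majorized_iff_top_sum
  by (intro allI impI weak_karamata[OF assms]) simp

section \<open>Least elements of integral supermodular polyhedra\<close>

lemma vsum_add: "vsum (x + y) A = vsum x A + vsum y A"
  by (simp add: vsum_def sum.distrib)

lemma vsum_diff: "vsum (x - y) A = vsum x A - vsum y A"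
  by (simp add: vsum_def sum_subtractf)

lemma vsum_axis: "vsum (axis i c) A = (if i \<in> A then c else 0)"
  by (simp add: vsum_def axis_def)

lemma vsum_Un_Int: "vsum x (A \<union> B) + vsum x (A \<inter> B) = vsum x A + vsum (x :: real ^ 'n) B"
  by (simp add: vsum_def sum.union_inter)

lemma vsum_in_Ints: "x \<in> integer_vectors \<Longrightarrow> vsum x A \<in> \<int>"
  by (auto simp: vsum_def integer_vectors_def intro: Ints_sum)

lemma integer_vectors_add: "x \<in> integer_vectors \<Longrightarrow> y \<in> integer_vectors \<Longrightarrow> x + y \<in> integer_vectors"
  by (auto simp: integer_vectors_def)

lemma integer_vectors_diff: "x \<in> integer_vectors \<Longrightarrow> y \<in> integer_vectors \<Longrightarrow> x - y \<in> integer_vectors"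
  by (auto simp: integer_vectors_def)

lemma axis_in_integer_vectors: "c \<in> \<int> \<Longrightarrow> axis i c \<in> integer_vectors"
  by (auto simp: integer_vectors_def axis_def)

lemma Ints_add_one_le: "a \<in> \<int> \<Longrightarrow> b \<in> \<int> \<Longrightarrow> a < b \<Longrightarrow> a + 1 \<le> (b :: real)"
  by (auto elim!: Ints_cases)

lemma P_sup_nonempty:
  fixes g :: "'n::finite set \<Rightarrow> real"
  assumes "\<And>A. g A \<in> \<int>" "g {} = 0"
  shows "P_sup g \<noteq> {}"
proof -
  define M where "M = (\<Sum>A\<in>UNIV. \<bar>g A\<bar>)"
  have M: "\<bar>g A\<bar> \<le> M" for A unfolding M_def by (rule member_le_sum) auto
  have "M \<in> \<int>" unfolding M_def using assms(1) by (auto intro!: Ints_sum Ints_abs)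
  moreover have "g A \<le> vsum (\<chi> i. M) A" for A
  proof (cases "A = {}")
    case False
    then have "1 \<le> card A" by (simp add: Suc_le_eq card_gt_0_iff)
    then have "1 * M \<le> real (card A) * M"
      using M[of A] by (intro mult_right_mono) auto
    then show ?thesis using M[of A] by (simp add: vsum_def)
  qed (simp add: vsum_def assms)
  ultimately have "(\<chi> i. M) \<in> P_sup g" by (simp add: P_sup_def integer_vectors_def)
  then show ?thesis by blast
qed

text \<open>
  An element of \<open>P_sup g\<close> that minimises a strictly increasing, strictly convex separable function
  cannot be improved by decreasing a component or by moving a unit from \<open>i\<close> to \<open>j\<close>.
\<close>

lemma P_sup_locally_minimal_exists:
  fixes g :: "'n::finite set \<Rightarrow> real"
  assumes "\<And>A. g A \<in> \<int>" "g {} = 0"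
  obtains x where "x \<in> P_sup g" "\<And>i. x - axis i 1 \<notin> P_sup g"
    "\<And>i j. x - axis i 1 + axis j 1 \<in> P_sup g \<Longrightarrow> x $ i \<le> x $ j + 1"
proof -
  \<comment> \<open>Adding \<open>K\<close> makes all components of elements of
    \<open>P_sup g\<close> nonnegative, where squaring is increasing. \<open>F\<close> takes natural
    number values on \<open>P_sup g\<close>, so a minimiser exists although this set is
    unbounded.\<close>
  define K where "K = (\<Sum>i\<in>UNIV. \<bar>g {i}\<bar>)"
  have gK: "\<bar>g {i}\<bar> \<le> K" for i unfolding K_def by (rule member_le_sum) auto
  have K: "0 \<le> y $ i + K" if "y \<in> P_sup g" for y i
  proof -
    have "g {i} \<le> vsum y {i}" using that unfolding P_sup_def by blast
    with gK[of i] show ?thesis by (simp add: vsum_def)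
  qed
  have "K \<in> \<int>" unfolding K_def using assms(1) by (auto intro!: Ints_sum Ints_abs)
  define F where "F y = (\<Sum>i\<in>UNIV. (y $ i + K)\<^sup>2)" for y :: "real ^ 'n"
  have F_Ints: "F y \<in> \<int>" if "y \<in> P_sup g" for y
    using that \<open>K \<in> \<int>\<close> by (auto simp: F_def P_sup_def integer_vectors_def intro!: Ints_sum Ints_power)
  have F_nonneg: "0 \<le> F y" for y by (simp add: F_def sum_nonneg)
  obtain x where x: "x \<in> P_sup g" "\<And>y. y \<in> P_sup g \<Longrightarrow> nat \<lfloor>F x\<rfloor> \<le> nat \<lfloor>F y\<rfloor>"
    using P_sup_nonempty[of g, OF assms] ex_has_least_nat[of "\<lambda>x. x \<in> P_sup g" _ "\<lambda>y. nat \<lfloor>F y\<rfloor>"] by blast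
  have min: "F x \<le> F y" if "y \<in> P_sup g" for y
  proof -
    have "\<lfloor>F x\<rfloor> \<le> \<lfloor>F y\<rfloor>" using x(2)[OF that] F_nonneg[of x] F_nonneg[of y] by (simp add: nat_le_eq_zle)
    then show ?thesis using F_Ints[OF x(1)] F_Ints[OF that] by (metis of_int_floor of_int_le_iff)
  qed
  have "x - axis i 1 \<notin> P_sup g" for i
  proof
    assume y: "x - axis i 1 \<in> P_sup g"
    have "F (x - axis i 1) - F x = (\<Sum>k\<in>UNIV. if k = i then 1 - 2 * (x $ i + K) else 0)"
      unfolding F_def sum_subtractf[symmetric]
      by (rule sum.cong) (auto simp: axis_def power2_eq_square algebra_simps)
    then have "F (x - axis i 1) - F x = 1 - 2 * (x $ i + K)" by simp
    \<comment> \<open>The lowered component is still nonnegative after the shift by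
      \<open>K\<close>; hence \<open>F\<close> would strictly decrease.\<close>
    moreover have "1 \<le> x $ i + K" using K[OF y, of i] by (simp add: axis_def)
    ultimately show False using min[OF y] by argo
  qed
  moreover have "x $ i \<le> x $ j + 1" if y: "x - axis i 1 + axis j 1 \<in> P_sup g" for i j
  proof (cases "i = j")
    case False
    have "F (x - axis i 1 + axis j 1) - F x = (\<Sum>k\<in>UNIV. (if k = i then 1 - 2 * (x $ i + K) else 0)
        + (if k = j then 1 + 2 * (x $ j + K) else 0))"
      unfolding F_def sum_subtractf[symmetric] using False
      by (intro sum.cong) (auto simp: axis_def power2_eq_square algebra_simps)
    then have "F (x - axis i 1 + axis j 1) - F x = 2 - 2 * (x $ i - x $ j)"
      by (simp add: sum.distrib)
    with min[OF y] show ?thesis by argo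
  qed simp
  ultimately show ?thesis using that x(1) by blast
qed

text \<open>The tight sets of a locally minimal \<open>x\<close> are closed under union and
  intersection, so each index \<open>i\<close> has a least tight set \<open>D i\<close>, and the
  exchange condition bounds \<open>x\<close> on \<open>D i\<close> from below by
  \<open>x $ i - 1\<close>. Unions of these sets certify both membership in \<open>B_sup g\<close>
  and minimality of the hinge sums.\<close>

lemma B_sup_least_exists:
  fixes g :: "'n::finite set \<Rightarrow> real"
  assumes int: "\<And>A. g A \<in> \<int>" and super: "supermodular g"
  obtains x where "x \<in> B_sup g"
    "\<And>y t. y \<in> P_sup g \<Longrightarrow> t \<in> \<int> \<Longrightarrow> hinge_sum x t \<le> hinge_sum y t"
proof -
  have g0: "g {} = 0" using super by (simp add: supermodular_def)
  obtain x where x: "x \<in> P_sup g" "\<And>i. x - axis i 1 \<notin> P_sup g"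
    "\<And>i j. x - axis i 1 + axis j 1 \<in> P_sup g \<Longrightarrow> x $ i \<le> x $ j + 1"
    using P_sup_locally_minimal_exists[of g, OF int g0] by blast
  have xint: "x \<in> integer_vectors" and xg: "\<And>A. g A \<le> vsum x A" using x(1) by (auto simp: P_sup_def)
  define tight where "tight A \<longleftrightarrow> vsum x A = g A" for A
  have slack: "g A + 1 \<le> vsum x A" if "\<not> tight A" for A
    using that xg[of A] int vsum_in_Ints[OF xint] by (intro Ints_add_one_le) (auto simp: tight_def)
  have tight_Un_Int: "tight (A \<union> B) \<and> tight (A \<inter> B)" if "tight A" "tight B" for A B
  proof -
    have "g A + g B \<le> g (A \<union> B) + g (A \<inter> B)" using super by (simp add: supermodular_def)
    with that vsum_Un_Int[of x A B] xg[of "A \<union> B"] xg[of "A \<inter> B"] show ?thesis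
      by (simp add: tight_def)
  qed
  have "\<exists>A. tight A \<and> i \<in> A" for i
  proof (rule ccontr)
    assume no: "\<not> (\<exists>A. tight A \<and> i \<in> A)"
    have "g A \<le> vsum (x - axis i 1) A" for A
      using no slack[of A] xg[of A] by (cases "tight A") (auto simp: vsum_diff vsum_axis)
    then have "x - axis i 1 \<in> P_sup g"
      using xint by (simp add: P_sup_def integer_vectors_diff axis_in_integer_vectors)
    with x(2) show False by blast
  qed
  then have "\<exists>D. (tight D \<and> i \<in> D) \<and> (\<forall>A. tight A \<and> i \<in> A \<longrightarrow> card D \<le> card A)" for i
    using ex_has_least_nat[of "\<lambda>A. tight A \<and> i \<in> A" _ card] by metis
  then obtain D where D: "\<And>i. tight (D i)" "\<And>i. i \<in> D i"
    and Dmin: "\<And>i A. tight A \<Longrightarrow> i \<in> A \<Longrightarrow> card (D i) \<le> card A"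
    by metis
  have D_sub: "D i \<subseteq> A" if "tight A" "i \<in> A" for i A
  proof -
    have "card (D i) \<le> card (D i \<inter> A)"
      using that D tight_Un_Int[of "D i" A] by (intro Dmin) auto
    then have "D i \<inter> A = D i" by (intro card_seteq) auto
    then show ?thesis by blast
  qed
  have D_le: "x $ i \<le> x $ j + 1" if "j \<in> D i" for i j
  proof (rule x(3))
    \<comment> \<open>Only sets that contain \<open>i\<close> but not \<open>j\<close> lose a unit.
      None of them is tight, because a tight set containing \<open>i\<close> includes
      \<open>D i\<close>, so integrality leaves a unit of slack.\<close>
    have "g A \<le> vsum (x - axis i 1 + axis j 1) A" for A
      using slack[of A] xg[of A] D_sub[of A i] that by (cases "tight A") (auto simp: vsum_add vsum_diff vsum_axis)
    then show "x - axis i 1 + axis j 1 \<in> P_sup g"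
      using xint by (simp add: P_sup_def integer_vectors_add integer_vectors_diff axis_in_integer_vectors)
  qed
  have tight_UN: "tight (\<Union>i\<in>H. D i)" for H
  proof (induction H rule: finite_induct[OF finite])
    case 1
    show ?case by (simp add: tight_def vsum_def g0)
  next
    case (2 i H)
    then show ?case using tight_Un_Int[OF D(1)[of i]] by simp
  qed
  have "(\<Union>i. D i) = UNIV" using D(2) by blast
  then have "x \<in> B_sup g" using x(1) tight_UN[of UNIV] by (simp add: B_sup_def tight_def)
  moreover have "hinge_sum x t \<le> hinge_sum y t" if y: "y \<in> P_sup g" and t: "t \<in> \<int>" for y t
  proof -
    \<comment> \<open>\<open>H\<close> itself need not be tight, but its enlargement
      \<open>U\<close> is. Enlarging is harmless for the hinge sum of \<open>x\<close>, since all
      components are at least \<open>t\<close> on \<open>U\<close> and at most \<open>t\<close>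
      outside.\<close>
    define H where "H = {i. t < x $ i}"
    define U where "U = (\<Union>i\<in>H. D i)"
    have H_le: "x $ i \<le> t" if "i \<notin> U" for i using that D(2) by (force simp: U_def H_def)
    have U_ge: "t \<le> x $ j" if j: "j \<in> U" for j
    proof -
      obtain i where i: "t < x $ i" "j \<in> D i" using j by (auto simp: U_def H_def)
      \<comment> \<open>Integrality gains the unit that the exchange bound \<open>D_le\<close>
        loses.\<close>
      have "t + 1 \<le> x $ i" using i t xint by (intro Ints_add_one_le) (auto simp: integer_vectors_def)
      with D_le[OF i(2)] show ?thesis by linarith
    qed
    have "hinge_sum x t = (\<Sum>i\<in>U. max 0 (x $ i - t))"
      unfolding hinge_sum_def using H_le by (intro sum.mono_neutral_right) auto
    also have "\<dots> = (\<Sum>i\<in>U. x $ i - t)" using U_ge by (intro sum.cong) (auto simp: max_def)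
    also have "\<dots> = g U - (\<Sum>i\<in>U. t)"
      using tight_UN[of H] by (simp add: sum_subtractf tight_def vsum_def U_def)
    also have "\<dots> \<le> vsum y U - (\<Sum>i\<in>U. t)" using y by (auto simp: P_sup_def)
    also have "\<dots> = (\<Sum>i\<in>U. y $ i - t)" by (simp add: sum_subtractf vsum_def)
    also have "\<dots> \<le> (\<Sum>i\<in>U. max 0 (y $ i - t))" by (intro sum_mono) auto
    also have "\<dots> \<le> hinge_sum y t" unfolding hinge_sum_def by (intro sum_mono2) auto
    finally show ?thesis .
  qed
  ultimately show ?thesis using that by blast
qed

section \<open>Prefix-minimal elements\<close>

lemma sorting_permutation_exists:
  fixes f :: "'n::{finite,linorder} \<Rightarrow> real"
  obtains \<pi> where "\<pi> permutes UNIV" "\<And>i j. i \<le> j \<Longrightarrow> f (\<pi> j) \<le> f (\<pi> i)"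
proof -
  \<comment> \<open>Negated keys turn the ascending sort into a descending one; \<open>rank\<close>
    below translates the abstract order of the index type into list positions.\<close>
  define l where "l = sort_key (\<lambda>i. - f i) (sorted_list_of_set (UNIV :: 'n set))"
  have l: "length l = CARD('n)" "distinct l" "sorted (map (\<lambda>i. - f i) l)"
    by (simp_all add: l_def)
  define rank where "rank i = card {..<i}" for i :: 'n
  have rank_less: "rank i < rank j" if "i < j" for i j
    unfolding rank_def using that by (intro psubset_card_mono) auto
  have rank_card: "rank i < CARD('n)" for i
    unfolding rank_def by (intro psubset_card_mono) auto
  have "inj (\<lambda>i. l ! rank i)"
  proof (rule injI)
    fix i j assume "l ! rank i = l ! rank j"
    then have "rank i = rank j" using l rank_card by (simp add: nth_eq_iff_index_eq)
    then show "i = j" using rank_less[of i j] rank_less[of j i] by (cases i j rule: linorder_cases) auto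
  qed
  then have "(\<lambda>i. l ! rank i) permutes UNIV"
    by (intro bij_imp_permutes) (auto simp: bij_betw_def finite_UNIV_inj_surj)
  moreover have "f (l ! rank j) \<le> f (l ! rank i)" if "i \<le> j" for i j
  proof -
    have "rank i \<le> rank j" using that rank_less[of i j] by (cases "i = j") (auto intro: less_imp_le)
    then show ?thesis using sorted_nth_mono[OF l(3), of "rank i" "rank j"] l(1) rank_card by simp
  qed
  ultimately show ?thesis using that by blast
qed

lemma downset_eq_atMost:
  fixes U :: "'n::{finite,linorder} set"
  assumes "U \<noteq> {}" "\<And>i j. i \<in> U \<Longrightarrow> j \<le> i \<Longrightarrow> j \<in> U"
  shows "U = {..Max U}"
proof
  show "U \<subseteq> {..Max U}" by auto
  have "Max U \<in> U" using assms(1) by (intro Max_in) auto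
  then show "{..Max U} \<subseteq> U" using assms(2) by blast
qed

text \<open>Listing the indices by decreasing \<open>f\<close> makes every upper set of
  \<open>f\<close> a prefix, also in the presence of ties, since an upper set contains all indices
  of equal weight or none. Hence one prefix-minimal vector serves all upper sets at once.\<close>

lemma prefix_minimal_imp_upper_set_minimal:
  fixes C :: "(real ^ 'n::{finite,linorder}) set" and f :: "'n \<Rightarrow> real"
  assumes "\<forall>\<pi> :: 'n \<Rightarrow> 'n. \<pi> permutes UNIV \<longrightarrow>
    (\<exists>xs\<in>C. \<forall>x\<in>C. \<forall>k. (\<Sum>i\<le>k. xs $ \<pi> i) \<le> (\<Sum>i\<le>k. x $ \<pi> i))"
  obtains xs where "xs \<in> C"
    "\<And>x U. x \<in> C \<Longrightarrow> (\<And>i j. i \<in> U \<Longrightarrow> f i \<le> f j \<Longrightarrow> j \<in> U) \<Longrightarrow> vsum xs U \<le> vsum x U"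
proof -
  obtain \<pi> where \<pi>: "\<pi> permutes UNIV" "\<And>i j. i \<le> j \<Longrightarrow> f (\<pi> j) \<le> f (\<pi> i)"
    using sorting_permutation_exists by blast
  obtain xs where xs: "xs \<in> C" "\<And>x k. x \<in> C \<Longrightarrow> (\<Sum>i\<le>k. xs $ \<pi> i) \<le> (\<Sum>i\<le>k. x $ \<pi> i)"
    using assms \<pi>(1) by blast
  have inj: "inj \<pi>" and surj: "surj \<pi>" using \<pi>(1) permutes_inj permutes_surj by blast+
  have "vsum xs U \<le> vsum x U"
    if x: "x \<in> C" and U: "\<And>i j. i \<in> U \<Longrightarrow> f i \<le> f j \<Longrightarrow> j \<in> U" for x U
  proof (cases "U = {}")
    case False
    have "\<pi> -` U = {..Max (\<pi> -` U)}"
    proof (rule downset_eq_atMost)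
      show "\<pi> -` U \<noteq> {}" using False surj by (metis image_empty surj_image_vimage_eq)
    qed (use U \<pi>(2) in auto)
    then obtain k where k: "\<pi> -` U = {..k}" by blast
    have "U = \<pi> ` {..k}" using surj k by (metis surj_image_vimage_eq)
    then have "vsum z U = (\<Sum>i\<le>k. z $ \<pi> i)" for z
      using inj by (simp add: vsum_def sum.reindex inj_on_def)
    then show ?thesis using xs(2)[OF x, of k] by simp
  qed (simp add: vsum_def)
  then show ?thesis using that xs(1) by blast
qed

lemma finite_bounded_integer_vectors:
  fixes C :: "(real ^ 'n) set"
  assumes "C \<subseteq> integer_vectors" "bounded C"
  shows "finite C"
proof -
  obtain M where M: "\<And>x. x \<in> C \<Longrightarrow> norm x \<le> M" using assms(2) by (auto simp: bounded_iff)
  let ?S = "{a :: real. a \<in> \<int> \<and> \<bar>a\<bar> \<le> M}"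
  have "C \<subseteq> (\<lambda>f. \<chi> i. f i) ` (PiE UNIV (\<lambda>_. ?S))"
  proof
    fix x assume x: "x \<in> C"
    have "x $ i \<in> ?S" for i
      using x M[OF x] assms(1) component_le_norm_cart[of x i] by (auto simp: integer_vectors_def)
    then have "($) x \<in> PiE UNIV (\<lambda>_. ?S)" by auto
    moreover have "x = (\<chi> i. x $ i)" by simp
    ultimately show "x \<in> (\<lambda>f. \<chi> i. f i) ` (PiE UNIV (\<lambda>_. ?S))" by blast
  qed
  moreover have "finite (PiE (UNIV :: 'n set) (\<lambda>_. ?S))"
    by (intro finite_PiE finite_abs_int_segment) auto
  ultimately show ?thesis using finite_subset by blast
qed

section \<open>Least elements, prefix minimality and supermodularity\<close>

lemma least_weakly_submajorized_imp_prefix_minimal: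
  fixes C :: "(real ^ 'n::{finite,linorder}) set"
  assumes "bounded C" and least: "\<forall>b\<in>integer_vectors. \<exists>x. least_weakly_submajorized b C x"
    and \<pi>: "\<pi> permutes (UNIV :: 'n set)"
  shows "\<exists>xs\<in>C. \<forall>x\<in>C. \<forall>k. (\<Sum>i\<le>k. xs $ \<pi> i) \<le> (\<Sum>i\<le>k. x $ \<pi> i)"
proof -
  obtain M0 where M0: "\<And>x. x \<in> C \<Longrightarrow> norm x \<le> M0" using assms(1) by (auto simp: bounded_iff)
  \<comment> \<open>The bound is rounded up to a natural number so that the shift \<open>b\<close>
    is integral.\<close>
  define M where "M = real (nat \<lceil>M0\<rceil>)"
  have M: "\<bar>x $ i\<bar> \<le> M" if "x \<in> C" for x i
    using M0[OF that] component_le_norm_cart[of x i] by (simp add: M_def) linarith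
  have "0 \<le> M" by (simp add: M_def)
  define rank where "rank i = real (card {..<i})" for i :: 'n
  have rank_mono: "rank i \<le> rank j" if "i \<le> j" for i j
    unfolding rank_def using that by (auto intro!: card_mono)
  have rank_less: "rank i + 1 \<le> rank j" if "i < j" for i j
  proof -
    have "card {..<i} < card {..<j}" using that by (intro psubset_card_mono) auto
    then show ?thesis by (simp add: rank_def)
  qed
  text \<open>The shift is so spread out that \<open>x + b\<close> is sorted by \<open>\<pi>\<close> for every \<open>x \<in> C\<close>.\<close>
  define b :: "real ^ 'n::{finite,linorder}" where "b = (\<chi> i. - (2 * M * rank (inv \<pi> i)))"
  have b: "b $ \<pi> i = - (2 * M * rank i)" for i
    using \<pi> by (simp add: b_def permutes_inverses)
  have "b \<in> integer_vectors" by (auto simp: integer_vectors_def b_def M_def rank_def)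
  then obtain xs where xs: "xs \<in> C" "\<And>y. y \<in> C \<Longrightarrow> weakly_submajorized b xs y"
    using least by (auto simp: least_weakly_submajorized_def)
  have "(\<Sum>i\<le>k. xs $ \<pi> i) \<le> (\<Sum>i\<le>k. x $ \<pi> i)" if x: "x \<in> C" for x k
  proof -
    \<comment> \<open>After the shift, component \<open>\<pi> i\<close> of a vector in
      \<open>C\<close> lies within \<open>M\<close> of \<open>- (2 * M * rank i)\<close>, and
      \<open>t\<close> is the lower end of this interval for \<open>k\<close>. So the hinge at
      \<open>t\<close> is linear on the prefix up to \<open>k\<close> and vanishes beyond it, and
      its sum is the prefix sum plus a constant.\<close>
    define t where "t = - (2 * M * rank k) - M"
    define \<phi> where "\<phi> u = max 0 (u - t)" for u
    have "mono \<phi>" by (auto simp: mono_def \<phi>_def)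
    moreover have "continuous_on UNIV \<phi>" unfolding \<phi>_def by (intro continuous_intros)
    moreover have "convex_on UNIV \<phi>"
    proof (rule convex_onI)
      fix s u v :: real assume s: "0 < s" "s < 1"
      then have "(1 - s) * (u - t) \<le> (1 - s) * \<phi> u" "s * (v - t) \<le> s * \<phi> v"
        by (auto intro!: mult_left_mono simp: \<phi>_def)
      then have "(1 - s) * u + s * v - t \<le> (1 - s) * \<phi> u + s * \<phi> v"
        by (simp add: algebra_simps)
      moreover have "0 \<le> (1 - s) * \<phi> u + s * \<phi> v" using s by (simp add: \<phi>_def)
      ultimately show "\<phi> ((1 - s) *\<^sub>R u + s *\<^sub>R v) \<le> (1 - s) * \<phi> u + s * \<phi> v"
        unfolding \<phi>_def[of "(1 - s) *\<^sub>R u + s *\<^sub>R v"] by simp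
    qed auto
    ultimately have le: "(\<Sum>i\<in>UNIV. \<phi> (xs $ i + b $ i)) \<le> (\<Sum>i\<in>UNIV. \<phi> (x $ i + b $ i))"
      using xs(2)[OF x] by (simp add: weakly_submajorized_def)
    have eq: "(\<Sum>i\<in>UNIV. \<phi> (z $ i + b $ i)) = (\<Sum>i\<le>k. z $ \<pi> i) + (\<Sum>i\<le>k. b $ \<pi> i - t)"
      if z: "z \<in> C" for z
    proof -
      have "(\<Sum>i\<in>UNIV. \<phi> (z $ i + b $ i)) = (\<Sum>i\<in>UNIV. \<phi> (z $ \<pi> i + b $ \<pi> i))"
        using \<pi> by (subst sum.permute[OF \<pi>]) (simp add: comp_def)
      also have "\<dots> = (\<Sum>i\<le>k. \<phi> (z $ \<pi> i + b $ \<pi> i))"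
      proof (rule sum.mono_neutral_right)
        show "\<forall>i\<in>UNIV - {..k}. \<phi> (z $ \<pi> i + b $ \<pi> i) = 0"
        proof
          fix i assume "i \<in> UNIV - {..k}"
          then have "2 * M * (rank k + 1) \<le> 2 * M * rank i"
            using rank_less[of k i] \<open>0 \<le> M\<close> by (intro mult_left_mono) auto
          then show "\<phi> (z $ \<pi> i + b $ \<pi> i) = 0"
            using M[OF z, of "\<pi> i"] by (simp add: \<phi>_def b t_def algebra_simps)
        qed
      qed auto
      also have "\<dots> = (\<Sum>i\<le>k. z $ \<pi> i + (b $ \<pi> i - t))"
      proof (rule sum.cong[OF refl])
        fix i assume "i \<in> {..k}"
        then have "2 * M * rank i \<le> 2 * M * rank k"
          using rank_mono[of i k] \<open>0 \<le> M\<close> by (intro mult_left_mono) auto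
        then show "\<phi> (z $ \<pi> i + b $ \<pi> i) = z $ \<pi> i + (b $ \<pi> i - t)"
          using M[OF z, of "\<pi> i"] by (simp add: \<phi>_def b t_def)
      qed
      finally show ?thesis by (simp add: sum.distrib)
    qed
    show ?thesis using le eq[OF x] eq[OF xs(1)] by simp
  qed
  with xs(1) show ?thesis by blast
qed

lemma prefix_minimal_imp_supermodular_min_fun:
  fixes C :: "(real ^ 'n::{finite,linorder}) set"
  assumes C: "C \<subseteq> integer_vectors" "bounded C" "hole_free C"
    and prefix: "\<forall>\<pi> :: 'n \<Rightarrow> 'n. \<pi> permutes UNIV \<longrightarrow>
      (\<exists>xs\<in>C. \<forall>x\<in>C. \<forall>k. (\<Sum>i\<le>k. xs $ \<pi> i) \<le> (\<Sum>i\<le>k. x $ \<pi> i))"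
  shows "\<forall>A. min_fun C A \<in> \<int>" "supermodular (min_fun C)"
    "B_sup (min_fun C) \<subseteq> C" "C \<subseteq> P_sup (min_fun C)"
proof -
  have fin: "finite C" using C finite_bounded_integer_vectors by blast
  \<comment> \<open>The identity permutation provides an element, so that \<open>min_fun C\<close>
    is a true minimum and not the unspecified \<open>Min {}\<close>.\<close>
  have ne: "C \<noteq> {}" using prefix permutes_id[of UNIV] by fast
  have le: "min_fun C A \<le> vsum x A" if "x \<in> C" for x A
    unfolding min_fun_def using that fin by simp
  have attained: "\<exists>x\<in>C. min_fun C A = vsum x A" for A
    unfolding min_fun_def using Min_in[of "(\<lambda>x. vsum x A) ` C"] fin ne by (metis (no_types, lifting) finite_imageI image_iff image_is_empty)
  then show "\<forall>A. min_fun C A \<in> \<int>" using C(1) vsum_in_Ints by (metis subsetD)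
  show "C \<subseteq> P_sup (min_fun C)" using C(1) le by (auto simp: P_sup_def)
  \<comment> \<open>Applied below to a weight with values 0, 1, 2 for supermodularity and to a
    separating normal for the inclusion of \<open>B_sup\<close>. Both times it matters that a single
    vector attains all these minima.\<close>
  have greedy: "\<exists>xs\<in>C. \<forall>U. (\<forall>i j. i \<in> U \<longrightarrow> f i \<le> f j \<longrightarrow> j \<in> U) \<longrightarrow> vsum xs U = min_fun C U"
    for f :: "'n \<Rightarrow> real"
  proof -
    obtain xs where xs: "xs \<in> C"
      "\<And>x U. x \<in> C \<Longrightarrow> (\<And>i j. i \<in> U \<Longrightarrow> f i \<le> f j \<Longrightarrow> j \<in> U) \<Longrightarrow> vsum xs U \<le> vsum x U"
      using prefix_minimal_imp_upper_set_minimal[OF prefix, of f] by metis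
    have "vsum xs U = min_fun C U" if "\<forall>i j. i \<in> U \<longrightarrow> f i \<le> f j \<longrightarrow> j \<in> U" for U
      using that xs(2)[of _ U] attained[of U] le[OF xs(1), of U] by (metis order_antisym)
    with xs(1) show ?thesis by blast
  qed
  show "supermodular (min_fun C)"
    unfolding supermodular_def
  proof (intro conjI allI)
    show "min_fun C {} = 0" using attained[of "{}"] by (simp add: vsum_def)
    fix A B :: "'n set"
    text \<open>Both \<open>A \<inter> B\<close> and \<open>A \<union> B\<close> are upper sets of this weight.\<close>
    define f :: "'n \<Rightarrow> real" where "f i = of_bool (i \<in> A) + of_bool (i \<in> B)" for i
    obtain xs where xs: "xs \<in> C"
      "\<And>U. (\<forall>i j. i \<in> U \<longrightarrow> f i \<le> f j \<longrightarrow> j \<in> U) \<Longrightarrow> vsum xs U = min_fun C U"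
      using greedy[of f] by blast
    have "vsum xs (A \<union> B) = min_fun C (A \<union> B)" "vsum xs (A \<inter> B) = min_fun C (A \<inter> B)"
      by (rule xs(2); auto simp: f_def of_bool_def split: if_splits)+
    then show "min_fun C A + min_fun C B \<le> min_fun C (A \<union> B) + min_fun C (A \<inter> B)"
      using le[OF xs(1), of A] le[OF xs(1), of B] vsum_Un_Int[of xs A B] by linarith
  qed
  show "B_sup (min_fun C) \<subseteq> C"
  proof
    fix x assume x: "x \<in> B_sup (min_fun C)"
    have "x \<in> convex hull C"
    proof (rule ccontr)
      assume "x \<notin> convex hull C"
      then obtain w \<beta> where w: "w \<bullet> x < \<beta>" "\<And>z. z \<in> convex hull C \<Longrightarrow> \<beta> < w \<bullet> z"
        using separating_hyperplane_closed_point[of "convex hull C" x] fin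
        by (auto simp: finite_imp_compact_convex_hull compact_imp_closed)
      obtain xs where xs: "xs \<in> C"
        "\<And>U. (\<forall>i j. i \<in> U \<longrightarrow> w $ i \<le> w $ j \<longrightarrow> j \<in> U) \<Longrightarrow> vsum xs U = min_fun C U"
        using greedy[of "($) w"] by blast
      \<comment> \<open>Abel summation wants nonnegative weights, so the minimum of \<open>w\<close>
        is subtracted. This costs only a multiple of the difference of totals, which vanishes
        because \<open>x\<close> and \<open>xs\<close> both have total
        \<open>min_fun C UNIV\<close>.\<close>
      define m where "m = Min (range (($) w))"
      have "0 \<le> (\<Sum>i\<in>UNIV. (w $ i - m) * (x $ i - xs $ i))"
      proof (rule sum_mult_nonneg_if_upper_sums_nonneg)
        fix U :: "'n set"
        assume "\<And>i j. i \<in> U \<Longrightarrow> j \<in> UNIV \<Longrightarrow> w $ i - m \<le> w $ j - m \<Longrightarrow> j \<in> U"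
        then have "vsum xs U = min_fun C U" by (intro xs(2)) auto
        moreover have "min_fun C U \<le> vsum x U" using x by (auto simp: B_sup_def P_sup_def)
        ultimately show "0 \<le> (\<Sum>i\<in>U. x $ i - xs $ i)" by (simp add: sum_subtractf vsum_def)
      qed (auto simp: m_def)
      also have "\<dots> = (\<Sum>i\<in>UNIV. w $ i * x $ i - w $ i * xs $ i - m * (x $ i - xs $ i))"
        by (intro sum.cong) (auto simp: algebra_simps)
      also have "\<dots> = w \<bullet> x - w \<bullet> xs - m * (vsum x UNIV - vsum xs UNIV)"
        by (simp only: inner_vec_def vsum_def sum_subtractf sum_distrib_left[symmetric] inner_real_def)
      also have "vsum x UNIV = vsum xs UNIV"
        using x xs(2)[of UNIV] unfolding B_sup_def by simp
      finally have "w \<bullet> xs \<le> w \<bullet> x" by simp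
      moreover have "\<beta> < w \<bullet> xs" using w(2) xs(1) hull_inc by metis
      ultimately show False using w(1) by linarith
    qed
    then show "x \<in> C" using x C(3) by (auto simp: hole_free_def B_sup_def P_sup_def)
  qed
qed

lemma supermodular_sandwich_imp_schur_minimal:
  fixes C :: "(real ^ 'n::{finite,linorder}) set"
  assumes g: "\<And>A. g A \<in> \<int>" "supermodular g" and C: "B_sup g \<subseteq> C" "C \<subseteq> P_sup g"
    and b: "b \<in> integer_vectors"
  shows "\<exists>xs\<in>C. \<forall>\<Phi> :: real ^ 'n::{finite,linorder} \<Rightarrow> real. mono \<Phi> \<longrightarrow> schur_convex \<Phi> \<longrightarrow> (\<forall>x\<in>C. \<Phi> (xs + b) \<le> \<Phi> (x + b))"
proof -
  \<comment> \<open>Adding a modular integral function preserves integrality and supermodularity,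
    and translates \<open>P_sup g\<close> and \<open>B_sup g\<close> by \<open>b\<close>.\<close>
  define h where "h A = g A + vsum b A" for A
  have "supermodular h" unfolding supermodular_def
  proof (intro conjI allI)
    show "h {} = 0" using g(2) by (simp add: h_def supermodular_def vsum_def)
    fix A B :: "'n set"
    have "g A + g B \<le> g (A \<union> B) + g (A \<inter> B)" using g(2) by (simp add: supermodular_def)
    then show "h A + h B \<le> h (A \<union> B) + h (A \<inter> B)"
      using vsum_Un_Int[of b A B] by (simp add: h_def)
  qed
  moreover have "h A \<in> \<int>" for A using g(1) vsum_in_Ints[OF b] by (simp add: h_def)
  ultimately obtain z where z: "z \<in> B_sup h"
    "\<And>y t. y \<in> P_sup h \<Longrightarrow> t \<in> \<int> \<Longrightarrow> hinge_sum z t \<le> hinge_sum y t"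
    using B_sup_least_exists[of h] by metis
  have "z - b \<in> B_sup g"
    using z(1) b by (auto simp: B_sup_def P_sup_def h_def vsum_diff integer_vectors_diff le_diff_eq)
  then have "z - b \<in> C" using C by blast
  moreover have "\<Phi> (z - b + b) \<le> \<Phi> (x + b)"
    if \<Phi>: "mono \<Phi>" "schur_convex \<Phi>" and x: "x \<in> C" for x and \<Phi> :: "real ^ 'n::{finite,linorder} \<Rightarrow> real"
  proof -
    have xb: "x + b \<in> P_sup h" using x C(2) b by (auto simp: P_sup_def h_def vsum_add integer_vectors_add)
    have "top_sum z k \<le> top_sum (x + b) k" if "k \<in> {1..CARD('n)}" for k
    proof (rule top_sum_mono_if_hinge_sum_mono)
      fix t assume "t \<in> range (($) (x + b))"
      then have "t \<in> \<int>" using xb unfolding P_sup_def integer_vectors_def by blast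
      then show "hinge_sum z t \<le> hinge_sum (x + b) t" by (rule z(2)[OF xb])
    qed (use that in auto)
    \<comment> \<open>Weak majorization splits into majorization by \<open>v\<close>, handled by
      Schur-convexity, and a componentwise increase from \<open>v\<close> to \<open>x + b\<close>,
      handled by monotonicity.\<close>
    then obtain v where "v \<le> x + b" "majorized z v" using majorized_below_if_top_sum_le by blast
    then have "\<Phi> z \<le> \<Phi> v" "\<Phi> v \<le> \<Phi> (x + b)"
      using \<Phi> by (auto simp: schur_convex_def mono_def)
    then show ?thesis by simp
  qed
  ultimately show ?thesis by blast
qed

text \<open>The separable sums that test weak submajorization are themselves admissible objectives;
  Karamata's inequality makes them Schur-convex.\<close>

lemma schur_minimal_imp_least_weakly_submajorized:
  fixes C :: "(real ^ 'n::{finite,linorder}) set"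
  assumes "xs \<in> C" and min: "\<forall>\<Phi> :: real ^ 'n::{finite,linorder} \<Rightarrow> real. mono \<Phi> \<longrightarrow> continuous_on UNIV \<Phi> \<longrightarrow>
      schur_convex \<Phi> \<longrightarrow> (\<forall>x\<in>C. \<Phi> (xs + b) \<le> \<Phi> (x + b))"
  shows "least_weakly_submajorized b C xs"
  unfolding least_weakly_submajorized_def weakly_submajorized_def
proof (intro conjI ballI allI impI)
  fix y and \<phi> :: "real \<Rightarrow> real"
  assume y: "y \<in> C" and \<phi>: "mono \<phi>" "continuous_on UNIV \<phi>" "convex_on UNIV \<phi>"
  let ?\<Phi> = "\<lambda>x :: real ^ 'n::{finite,linorder}. \<Sum>i\<in>UNIV. \<phi> (x $ i)"
  have "mono ?\<Phi>" using \<phi>(1) by (auto simp: mono_def less_eq_vec_def intro!: sum_mono)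
  moreover have "continuous_on UNIV ?\<Phi>"
    by (intro continuous_intros continuous_on_compose2[OF \<phi>(2)]) auto
  moreover have "schur_convex ?\<Phi>" using \<phi> by (intro schur_convex_sum)
  ultimately have "?\<Phi> (xs + b) \<le> ?\<Phi> (y + b)" using min y by blast
  then show "(\<Sum>i\<in>UNIV. \<phi> (xs $ i + b $ i)) \<le> (\<Sum>i\<in>UNIV. \<phi> (y $ i + b $ i))" by simp
qed fact

theorem theorem4:
  fixes C :: "(real ^ 'n::{finite,linorder}) set"
  assumes "C \<subseteq> integer_vectors" and "bounded C" and "hole_free C"
  shows "let
      S1 = (\<forall>b\<in>integer_vectors. \<exists>x. least_weakly_submajorized b C x);
      S2 = (\<forall>b\<in>integer_vectors. \<exists>xs\<in>C. \<forall>\<Phi> :: real ^ 'n::{finite,linorder} \<Rightarrow> real.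
              mono \<Phi> \<longrightarrow> continuous_on UNIV \<Phi> \<longrightarrow> schur_convex \<Phi> \<longrightarrow>
              (\<forall>x\<in>C. \<Phi> (xs + b) \<le> \<Phi> (x + b)));
      S3 = (\<forall>\<pi> :: 'n \<Rightarrow> 'n. \<pi> permutes UNIV \<longrightarrow>
              (\<exists>xs\<in>C. \<forall>x\<in>C. \<forall>k. (\<Sum>i\<le>k. xs $ \<pi> i) \<le> (\<Sum>i\<le>k. x $ \<pi> i)));
      S4 = ((\<forall>A. min_fun C A \<in> \<int>) \<and> supermodular (min_fun C) \<and>
              B_sup (min_fun C) \<subseteq> C \<and> C \<subseteq> P_sup (min_fun C))
    in (S1 \<longleftrightarrow> S2) \<and> (S2 \<longleftrightarrow> S3) \<and> (S3 \<longleftrightarrow> S4)"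
proof -
  define S1 where "S1 \<longleftrightarrow> (\<forall>b\<in>integer_vectors. \<exists>x. least_weakly_submajorized b C x)"
  define S2 where "S2 \<longleftrightarrow> (\<forall>b\<in>integer_vectors. \<exists>xs\<in>C. \<forall>\<Phi> :: real ^ 'n::{finite,linorder} \<Rightarrow> real.
    mono \<Phi> \<longrightarrow> continuous_on UNIV \<Phi> \<longrightarrow> schur_convex \<Phi> \<longrightarrow> (\<forall>x\<in>C. \<Phi> (xs + b) \<le> \<Phi> (x + b)))"
  define S3 where "S3 \<longleftrightarrow> (\<forall>\<pi> :: 'n \<Rightarrow> 'n. \<pi> permutes UNIV \<longrightarrow>
    (\<exists>xs\<in>C. \<forall>x\<in>C. \<forall>k. (\<Sum>i\<le>k. xs $ \<pi> i) \<le> (\<Sum>i\<le>k. x $ \<pi> i)))"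
  define S4 where "S4 \<longleftrightarrow> (\<forall>A. min_fun C A \<in> \<int>) \<and> supermodular (min_fun C) \<and>
    B_sup (min_fun C) \<subseteq> C \<and> C \<subseteq> P_sup (min_fun C)"
  have "S1 \<Longrightarrow> S3"
    unfolding S1_def S3_def using least_weakly_submajorized_imp_prefix_minimal[OF assms(2)] by blast
  moreover have "S3 \<Longrightarrow> S4"
    unfolding S3_def S4_def using prefix_minimal_imp_supermodular_min_fun[OF assms] by blast
  moreover have S2 if "S4"
    unfolding S2_def
  proof
    fix b :: "real ^ 'n::{finite,linorder}" assume "b \<in> integer_vectors"
    with that show "\<exists>xs\<in>C. \<forall>\<Phi> :: real ^ 'n::{finite,linorder} \<Rightarrow> real. mono \<Phi> \<longrightarrow>
        continuous_on UNIV \<Phi> \<longrightarrow> schur_convex \<Phi> \<longrightarrow> (\<forall>x\<in>C. \<Phi> (xs + b) \<le> \<Phi> (x + b))"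
      using supermodular_sandwich_imp_schur_minimal[of "min_fun C" C b] unfolding S4_def by blast
  qed
  moreover have S1 if "S2"
    unfolding S1_def
  proof
    fix b :: "real ^ 'n::{finite,linorder}" assume "b \<in> integer_vectors"
    with that obtain xs where "xs \<in> C" "\<forall>\<Phi> :: real ^ 'n::{finite,linorder} \<Rightarrow> real. mono \<Phi> \<longrightarrow>
        continuous_on UNIV \<Phi> \<longrightarrow> schur_convex \<Phi> \<longrightarrow> (\<forall>x\<in>C. \<Phi> (xs + b) \<le> \<Phi> (x + b))"
      unfolding S2_def by blast
    then show "\<exists>x. least_weakly_submajorized b C x"
      by (intro exI[of _ xs] schur_minimal_imp_least_weakly_submajorized)
  qed
  ultimately have "(S1 \<longleftrightarrow> S2) \<and> (S2 \<longleftrightarrow> S3) \<and> (S3 \<longleftrightarrow> S4)" by blast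
  then show ?thesis unfolding S1_def S2_def S3_def S4_def Let_def .
qed

end
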